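(* Let $\mathbb{X}$ be a finite-dimensional real inner product space and $T:\mathbb{X}\rightrightarrows\mathbb{X}$ a maximal monotone operator with $T^{-1}(0)\neq\emptyset$. Let $\{(x^k,y^k)\}$ be sequences generated by the VMOR-HPE framework (defined in the context) applied to $T$. Then $\{x^k\}$ and $\{y^k\}$ both converge to a common point $x^\infty\in T^{-1}(0)$.
   Context: Notation. For a self-adjoint positive definite linear operator $\mathcal{M}$ on $\mathbb{X}$, $\|x\|_{\mathcal{M}}=\sqrt{\langle x,\mathcal{M}x\rangle}$; $\preceq$ is the Loewner order; $\mathcal{I}$ is the identity. For $\epsilon\ge 0$ the $\epsilon$-enlargement of $T$ is $T^{[\epsilon]}(x)=\{v\in\mathbb{X}\mid \langle w-v,z-x\rangle\ge-\epsilon\ \ \forall z\in\mathbb{X},\ \forall w\in T(z)\}$, and $\mathrm{gph}\,T^{[\epsilon]}=\{(x,v)\mid v\in T^{[\epsilon]}(x)\}$. VMOR-HPE framework. Parameters: $\underline{\omega},\overline{\omega}>0$, $\underline{\theta}>-1$, $\sigma\in[0,1)$, $\underline{c}>0$, $\xi_k\ge 0$ with $\sum_k\xi_k<\infty$; a self-adjoint operator $\mathcal{M}_0$ with $\underline{\omega}\mathcal{I}\preceq\mathcal{M}_0\preceq\overline{\omega}\mathcal{I}$; a starting point $x^0\in\mathbb{X}$. For $k=0,1,2,\ldots$: choose $c_k\ge\underline{c}$ and $\theta_k\in[\underline{\theta},\infty)$; find $(\epsilon_k,y^k,v^k)\in\mathbb{R}_+\times\mathbb{X}\times\mathbb{X}$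 satisfying (a) $(y^k,v^k)\in\mathrm{gph}\,T^{[\epsilon_k]}$, (b) $\theta_k\|c_k\mathcal{M}_k^{-1}v^k\|_{\mathcal{M}_k}^2+\|c_k\mathcal{M}_k^{-1}v^k+(y^k-x^k)\|_{\mathcal{M}_k}^2+2c_k\epsilon_k\le\sigma\|y^k-x^k\|_{\mathcal{M}_k}^2$; set $x^{k+1}=x^k-(1+\theta_k)c_k\mathcal{M}_k^{-1}v^k$; choose a self-adjoint operator $\mathcal{M}_{k+1}$ with $\underline{\omega}\mathcal{I}\preceq\mathcal{M}_{k+1}\preceq(1+\xi_k)\mathcal{M}_k$. *)

theory Defs
  imports "HOL-Analysis.Analysis"
begin

definition gph :: "('a \<Rightarrow> 'a set) \<Rightarrow> ('a \<times> 'a) set" where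
  "gph T = {(x, v). v \<in> T x}"

definition inverse_op :: "('a \<Rightarrow> 'a set) \<Rightarrow> 'a \<Rightarrow> 'a set" where
  "inverse_op T v = {x. v \<in> T x}"

definition monotone_op :: "('a::real_inner \<Rightarrow> 'a set) \<Rightarrow> bool" where
  "monotone_op T \<longleftrightarrow> (\<forall>(x, v) \<in> gph T. \<forall>(z, w) \<in> gph T. (w - v) \<bullet> (z - x) \<ge> 0)"

definition maximal_monotone_op :: "('a::real_inner \<Rightarrow> 'a set) \<Rightarrow> bool" where
  "maximal_monotone_op T \<longleftrightarrow>
     monotone_op T \<and> (\<forall>S. monotone_op S \<and> gph T \<subseteq> gph S \<longrightarrow> gph S = gph T)"

definition enlargement :: "real \<Rightarrow> ('a::real_inner \<Rightarrow> 'a set) \<Rightarrow> 'a \<Rightarrow> 'a set" where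
  "enlargement \<epsilon> T x = {v. \<forall>z. \<forall>w \<in> T z. (w - v) \<bullet> (z - x) \<ge> - \<epsilon>}"

definition self_adjoint :: "('a::euclidean_space \<Rightarrow> 'a) \<Rightarrow> bool" where
  "self_adjoint A \<longleftrightarrow> linear A \<and> adjoint A = A"

text \<open>
  The Loewner order: \<open>B - A\<close> is positive semidefinite. It is only used between operators
  that are separately required to be self-adjoint.
\<close>

definition loewner_le :: "('a::real_inner \<Rightarrow> 'a) \<Rightarrow> ('a \<Rightarrow> 'a) \<Rightarrow> bool"
  (infix \<open>\<preceq>\<^sub>L\<close> 50) where
  "A \<preceq>\<^sub>L B \<longleftrightarrow> (\<forall>x. x \<bullet> (B x - A x) \<ge> 0)"

definition opnorm :: "('a::real_inner \<Rightarrow> 'a) \<Rightarrow> 'a \<Rightarrow> real" where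
  "opnorm M x = sqrt (x \<bullet> M x)"

text \<open>
  The sequences are one arbitrary run of the framework, the starting point being \<open>x 0\<close>.
  The bounds \<open>\<omega>\<^sub>l \<I> \<preceq> M k\<close> with \<open>\<omega>\<^sub>l > 0\<close> make every \<open>M k\<close> bijective, so \<open>inv (M k)\<close> is the
  genuine inverse operator.
\<close>

locale VMOR_HPE =
  fixes T :: "'a::euclidean_space \<Rightarrow> 'a set"
    and \<omega>\<^sub>l \<omega>\<^sub>u \<theta>\<^sub>l \<sigma> c\<^sub>l :: real
    and \<xi> :: "nat \<Rightarrow> real"
    and M :: "nat \<Rightarrow> 'a \<Rightarrow> 'a"
    and c \<theta> \<epsilon> :: "nat \<Rightarrow> real"
    and x y v :: "nat \<Rightarrow> 'a"
  assumes omega_pos: "\<omega>\<^sub>l > 0" "\<omega>\<^sub>u > 0"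
    and theta_lower: "\<theta>\<^sub>l > -1"
    and sigma_range: "\<sigma> \<in> {0..<1}"
    and c_lower_pos: "c\<^sub>l > 0"
    and xi_nonneg: "\<And>k. \<xi> k \<ge> 0"
    and xi_summable: "summable \<xi>"
    and M0_self_adjoint: "self_adjoint (M 0)"
    and M0_bounds: "(\<lambda>z. \<omega>\<^sub>l *\<^sub>R z) \<preceq>\<^sub>L M 0" "M 0 \<preceq>\<^sub>L (\<lambda>z. \<omega>\<^sub>u *\<^sub>R z)"
    and c_ge: "\<And>k. c k \<ge> c\<^sub>l"
    and theta_ge: "\<And>k. \<theta> k \<ge> \<theta>\<^sub>l"
    and eps_nonneg: "\<And>k. \<epsilon> k \<ge> 0"
    and inclusion: "\<And>k. (y k, v k) \<in> gph (enlargement (\<epsilon> k) T)"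
    and error_criterion:
      "\<And>k. \<theta> k * (opnorm (M k) (c k *\<^sub>R inv (M k) (v k)))\<^sup>2
            + (opnorm (M k) (c k *\<^sub>R inv (M k) (v k) + (y k - x k)))\<^sup>2
            + 2 * c k * \<epsilon> k
          \<le> \<sigma> * (opnorm (M k) (y k - x k))\<^sup>2"
    and x_update: "\<And>k. x (Suc k) = x k - ((1 + \<theta> k) * c k) *\<^sub>R inv (M k) (v k)"
    and M_self_adjoint: "\<And>k. self_adjoint (M (Suc k))"
    and M_bounds: "\<And>k. (\<lambda>z. \<omega>\<^sub>l *\<^sub>R z) \<preceq>\<^sub>L M (Suc k)"
      "\<And>k. M (Suc k) \<preceq>\<^sub>L (\<lambda>z. (1 + \<xi> k) *\<^sub>R M k z)"

end

theory Submission
  imports Defs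
begin

text \<open>
  Write \<open>u\<^sub>k = c\<^sub>k M\<^sub>k\<^sup>-\<^sup>1 v\<^sub>k\<close> and \<open>d\<^sub>k = y\<^sub>k - x\<^sub>k\<close>, so that \<open>x\<^sub>k\<^sub>+\<^sub>1 = x\<^sub>k - (1 + \<theta>\<^sub>k) u\<^sub>k\<close>, and
  fix a zero \<open>z\<close> of \<open>T\<close>. Testing the enlargement at the pair \<open>(z, 0)\<close> bounds
  \<open>\<langle>u\<^sub>k, x\<^sub>k - z\<rangle>\<close> in the \<open>M\<^sub>k\<close> inner product from below, and the error criterion is tailored to
  absorb exactly the terms that are left when \<open>\<parallel>x\<^sub>k\<^sub>+\<^sub>1 - z\<parallel>\<^sup>2\<close> is expanded. The result is the
  variable-metric Fejer inequality (lemma \<open>step_decrease\<close>)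
  \<open>\<parallel>x\<^sub>k\<^sub>+\<^sub>1 - z\<parallel>\<^sup>2 \<le> \<parallel>x\<^sub>k - z\<parallel>\<^sup>2 - (1 + \<theta>\<^sub>k)(1 - \<sigma>) \<parallel>d\<^sub>k\<parallel>\<^sup>2\<close> in the norm of \<open>M\<^sub>k\<close>.

  Passing to the metric \<open>M\<^sub>k\<^sub>+\<^sub>1\<close> costs a factor \<open>1 + \<xi>\<^sub>k\<close>. Dividing the squared distance by
  \<open>\<Prod>i<k. 1 + \<xi>\<^sub>i\<close>, which stays between \<open>1\<close> and a finite bound, turns it into a genuinely
  nonincreasing sequence (lemma \<open>scaled_dist_decrease\<close>). Hence the iterates are bounded and
  \<open>d\<^sub>k \<rightarrow> 0\<close>. The error criterion bounds \<open>u\<^sub>k\<close>, \<open>v\<^sub>k\<close> and \<open>\<epsilon>\<^sub>k\<close> by multiples of powers of \<open>\<parallel>d\<^sub>k\<parallel>\<close>,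
  because the metrics are uniformly equivalent to the Euclidean one, so these vanish too, and by
  maximality every cluster point of \<open>x\<close> is a zero of \<open>T\<close> (lemma \<open>zero_of_limit_enlargement\<close>).
  Finally, the scaled distance to such a cluster point is nonincreasing and tends to \<open>0\<close> along a
  subsequence, hence tends to \<open>0\<close>.
\<close>

section \<open>Positive semidefinite operators\<close>

lemma self_adjoint_linear: "self_adjoint A \<Longrightarrow> linear A"
  by (simp add: self_adjoint_def)

lemma self_adjoint_inner: "self_adjoint A \<Longrightarrow> A a \<bullet> b = a \<bullet> A b"
  using adjoint_works[of A a b] by (simp add: self_adjoint_def inner_commute)

lemma self_adjoint_quadratic_diff:
  assumes "self_adjoint A"
  shows "(a - t *\<^sub>R b) \<bullet> A (a - t *\<^sub>R b) = a \<bullet> A a - 2 * t * (b \<bullet> A a) + t\<^sup>2 * (b \<bullet> A b)"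
proof -
  have "a \<bullet> A b = b \<bullet> A a"
    using self_adjoint_inner[OF assms, of b a] by (simp add: inner_commute)
  moreover have "A (a - t *\<^sub>R b) = A a - t *\<^sub>R A b"
    using self_adjoint_linear[OF assms] by (simp add: linear_diff linear_scale)
  ultimately show ?thesis
    by (simp only: inner_diff_left inner_diff_right inner_scaleR_left inner_scaleR_right)
      (simp add: power2_eq_square algebra_simps)
qed

lemma self_adjoint_quadratic_add:
  assumes "self_adjoint A"
  shows "(a + b) \<bullet> A (a + b) = a \<bullet> A a + 2 * (a \<bullet> A b) + b \<bullet> A b"
proof -
  have "b \<bullet> A a = a \<bullet> A b"
    using self_adjoint_inner[OF assms, of a b] by (simp add: inner_commute)
  moreover have "A (a + b) = A a + A b"
    using self_adjoint_linear[OF assms] by (simp add: linear_add)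
  ultimately show ?thesis
    by (simp add: inner_add_left inner_add_right)
qed

text \<open>
  The quadratic form of a positive semidefinite operator controls its operator norm. Expanding
  the form at \<open>a - A a / L\<close>, one gradient step with step length \<open>1 / L\<close>, gives
  \<open>\<parallel>A a\<parallel>\<^sup>2 \<le> L \<langle>a, A a\<rangle>\<close>, and Cauchy-Schwarz finishes.
\<close>

lemma norm_le_of_quadratic_bounds:
  assumes "self_adjoint A" and "L > 0"
    and "\<And>z. 0 \<le> z \<bullet> A z" and upper: "\<And>z. z \<bullet> A z \<le> L * (norm z)\<^sup>2"
  shows "norm (A a) \<le> L * norm a"
proof -
  define t where "t = 1 / L"
  have "0 \<le> (a - t *\<^sub>R A a) \<bullet> A (a - t *\<^sub>R A a)" by (rule assms(3))
  also have "\<dots> = a \<bullet> A a - 2 * t * (norm (A a))\<^sup>2 + t\<^sup>2 * (A a \<bullet> A (A a))"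
    by (simp only: self_adjoint_quadratic_diff[OF assms(1)] power2_norm_eq_inner)
  also have "\<dots> \<le> a \<bullet> A a - 2 * t * (norm (A a))\<^sup>2 + t\<^sup>2 * (L * (norm (A a))\<^sup>2)"
    by (intro add_left_mono mult_left_mono upper) auto
  also have "\<dots> = a \<bullet> A a - (norm (A a))\<^sup>2 / L"
    using \<open>L > 0\<close> by (simp add: t_def power2_eq_square field_simps)
  finally have "(norm (A a))\<^sup>2 \<le> L * (a \<bullet> A a)"
    using \<open>L > 0\<close> by (simp add: field_simps)
  also have "\<dots> \<le> L * (norm a * norm (A a))"
    using \<open>L > 0\<close> by (intro mult_left_mono norm_cauchy_schwarz) auto
  finally have "norm (A a) * norm (A a) \<le> (L * norm a) * norm (A a)"
    by (simp add: power2_eq_square mult.assoc)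
  then show ?thesis
    using \<open>L > 0\<close> by (cases "A a = 0") auto
qed

lemma loewner_lower_bound:
  "(\<lambda>z. r *\<^sub>R z) \<preceq>\<^sub>L A \<Longrightarrow> r * (norm z)\<^sup>2 \<le> z \<bullet> A z"
  by (simp add: loewner_le_def inner_diff_right power2_norm_eq_inner)

section \<open>Zeros as limits of points in enlargements\<close>

text \<open>
  If \<open>0\<close> were missing from \<open>T p\<close>, adding it would give a larger monotone operator.
\<close>

lemma maximal_monotone_zero:
  assumes "maximal_monotone_op T"
    and related: "\<And>z w. w \<in> T z \<Longrightarrow> 0 \<le> w \<bullet> (z - p)"
  shows "0 \<in> T p"
proof -
  define S where "S = T(p := insert 0 (T p))"
  have gph_S: "gph S = insert (p, 0) (gph T)"
    by (auto simp: gph_def S_def split: if_splits)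
  have mono: "0 \<le> (w - w') \<bullet> (z - z')" if "w' \<in> T z'" "w \<in> T z" for z z' w w'
    using assms(1) that unfolding maximal_monotone_op_def monotone_op_def gph_def by blast
  have flip: "0 \<le> (0 - w) \<bullet> (p - z)" if "w \<in> T z" for z w
    using related[OF that] by (simp add: inner_diff_right)
  have "monotone_op S"
    unfolding monotone_op_def gph_S
    using mono flip related by (auto simp: gph_def)
  moreover have "gph T \<subseteq> gph S"
    unfolding gph_S by (rule subset_insertI)
  ultimately have "gph S = gph T"
    using assms(1) unfolding maximal_monotone_op_def by simp
  then show ?thesis
    unfolding gph_S by (auto simp: gph_def)
qed

lemma zero_of_limit_enlargement:
  assumes "maximal_monotone_op T"
    and mem: "\<And>k. (y k, v k) \<in> gph (enlargement (\<epsilon> k) T)"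
    and "y \<longlonglongrightarrow> p" "v \<longlonglongrightarrow> 0" "\<epsilon> \<longlonglongrightarrow> 0"
  shows "0 \<in> T p"
proof (rule maximal_monotone_zero[OF assms(1)])
  fix z w assume "w \<in> T z"
  then have ge: "- \<epsilon> k \<le> (w - v k) \<bullet> (z - y k)" for k
    using mem[of k] by (auto simp: gph_def enlargement_def)
  have "(\<lambda>k. (w - v k) \<bullet> (z - y k)) \<longlonglongrightarrow> (w - 0) \<bullet> (z - p)"
    by (intro tendsto_intros assms)
  moreover have "(\<lambda>k. - \<epsilon> k) \<longlonglongrightarrow> - 0"
    by (intro tendsto_intros assms)
  ultimately have "- 0 \<le> (w - 0) \<bullet> (z - p)"
    using ge by (intro LIMSEQ_le[of "\<lambda>k. - \<epsilon> k"]) auto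
  then show "0 \<le> w \<bullet> (z - p)" by simp
qed

section \<open>Uniform equivalence of the metrics\<close>

context VMOR_HPE
begin

definition growth :: "nat \<Rightarrow> real" where
  "growth k = (\<Prod>i<k. 1 + \<xi> i)"

lemma growth_Suc: "growth (Suc k) = (1 + \<xi> k) * growth k"
  by (simp add: growth_def mult.commute)

lemma growth_ge_1: "1 \<le> growth k"
  unfolding growth_def using xi_nonneg by (intro prod_ge_1) simp

lemma growth_le: "growth k \<le> exp (suminf \<xi>)"
proof -
  have "growth k \<le> (\<Prod>i<k. exp (\<xi> i))"
    unfolding growth_def using xi_nonneg by (intro prod_mono) (simp add: add_nonneg_nonneg)
  also have "\<dots> = exp (\<Sum>i<k. \<xi> i)" by (simp add: exp_sum)
  also have "\<dots> \<le> exp (suminf \<xi>)"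
    using sum_le_suminf[OF xi_summable] xi_nonneg by simp
  finally show ?thesis .
qed

definition metric_bound :: real where
  "metric_bound = exp (suminf \<xi>) * \<omega>\<^sub>u"

lemma metric_bound_pos: "0 < metric_bound"
  using omega_pos by (simp add: metric_bound_def)

lemma metric_self_adjoint: "self_adjoint (M k)"
  using M0_self_adjoint M_self_adjoint by (cases k) auto

lemma metric_lower: "\<omega>\<^sub>l * (norm z)\<^sup>2 \<le> z \<bullet> M k z"
  using loewner_lower_bound M0_bounds(1) M_bounds(1) by (cases k) auto

lemma metric_nonneg: "0 \<le> z \<bullet> M k z"
  using metric_lower[of z k] omega_pos by (smt (verit) mult_nonneg_nonneg zero_le_power2)

lemma metric_Suc_le: "z \<bullet> M (Suc k) z \<le> (1 + \<xi> k) * (z \<bullet> M k z)"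
  using M_bounds(2)[of k] by (simp add: loewner_le_def inner_diff_right)

lemma metric_upper: "z \<bullet> M k z \<le> metric_bound * (norm z)\<^sup>2"
proof -
  have "z \<bullet> M k z \<le> growth k * (\<omega>\<^sub>u * (norm z)\<^sup>2)"
  proof (induction k)
    case 0
    then show ?case
      using M0_bounds(2)
      by (simp add: growth_def loewner_le_def inner_diff_right power2_norm_eq_inner)
  next
    case (Suc k)
    have "z \<bullet> M (Suc k) z \<le> (1 + \<xi> k) * (z \<bullet> M k z)" by (rule metric_Suc_le)
    also have "\<dots> \<le> (1 + \<xi> k) * (growth k * (\<omega>\<^sub>u * (norm z)\<^sup>2))"
      using Suc xi_nonneg[of k] by (intro mult_left_mono) auto
    finally show ?case by (simp add: growth_Suc mult.assoc)
  qed
  also have "\<dots> \<le> exp (suminf \<xi>) * (\<omega>\<^sub>u * (norm z)\<^sup>2)"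
    using growth_le omega_pos by (intro mult_right_mono) auto
  finally show ?thesis by (simp add: metric_bound_def mult.assoc)
qed

lemma metric_norm_le: "norm (M k z) \<le> metric_bound * norm z"
  by (rule norm_le_of_quadratic_bounds[OF metric_self_adjoint metric_bound_pos
        metric_nonneg metric_upper])

lemma metric_inv: "M k (inv (M k) z) = z"
proof -
  have lin: "linear (M k)" by (rule self_adjoint_linear[OF metric_self_adjoint])
  have "a = 0" if "M k a = 0" for a
    using metric_lower[of a k] that omega_pos by (simp add: mult_le_0_iff)
  then have "inj (M k)" using linear_injective_0[OF lin] by blast
  then have "surj (M k)" by (rule linear_inj_imp_surj[OF lin])
  then show ?thesis by (rule surj_f_inv_f)
qed

lemma opnorm_sq: "(opnorm (M k) z)\<^sup>2 = z \<bullet> M k z"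
  by (simp add: opnorm_def metric_nonneg)

section \<open>One step of the method\<close>

definition dir :: "nat \<Rightarrow> 'a" where
  "dir k = c k *\<^sub>R inv (M k) (v k)"

definition gap :: "nat \<Rightarrow> 'a" where
  "gap k = y k - x k"

lemma c_pos: "0 < c k"
  using c_ge[of k] c_lower_pos by linarith

lemma metric_dir: "M k (dir k) = c k *\<^sub>R v k"
  using self_adjoint_linear[OF metric_self_adjoint]
  by (simp add: dir_def linear_scale metric_inv)

lemma x_Suc: "x (Suc k) = x k - (1 + \<theta> k) *\<^sub>R dir k"
  by (simp add: x_update dir_def)

lemma error_criterion_expanded:
  "(1 + \<theta> k) * (dir k \<bullet> M k (dir k)) + 2 * (dir k \<bullet> M k (gap k)) + 2 * c k * \<epsilon> k
    \<le> - (1 - \<sigma>) * (gap k \<bullet> M k (gap k))"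
proof -
  have "\<theta> k * (dir k \<bullet> M k (dir k)) + (dir k + gap k) \<bullet> M k (dir k + gap k) + 2 * c k * \<epsilon> k
      \<le> \<sigma> * (gap k \<bullet> M k (gap k))"
    using error_criterion[of k] by (simp only: opnorm_sq flip: dir_def gap_def)
  then show ?thesis
    unfolding self_adjoint_quadratic_add[OF metric_self_adjoint] by (simp add: algebra_simps)
qed

text \<open>
  After expanding the square, the factor multiplying \<open>1 + \<theta>\<^sub>k\<close> is at most the left-hand side of
  the expanded error criterion, the inequality between the two being the enlargement tested at
  \<open>(z, 0)\<close>.
\<close>

lemma step_decrease:
  assumes "0 \<in> T z"
  shows "(x (Suc k) - z) \<bullet> M k (x (Suc k) - z)
    \<le> (x k - z) \<bullet> M k (x k - z) - (1 + \<theta> k) * (1 - \<sigma>) * (gap k \<bullet> M k (gap k))"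
proof -
  have "- \<epsilon> k \<le> (0 - v k) \<bullet> (z - y k)"
    using inclusion[of k] assms unfolding gph_def enlargement_def by blast
  then have "c k * - \<epsilon> k \<le> c k * (v k \<bullet> (y k - z))"
    using c_pos[of k] by (intro mult_left_mono) (auto simp: inner_diff_right)
  also have "\<dots> = dir k \<bullet> M k (gap k) + dir k \<bullet> M k (x k - z)"
    by (simp add: metric_dir gap_def inner_diff_right algebra_simps
        flip: self_adjoint_inner[OF metric_self_adjoint])
  finally have "- 2 * (dir k \<bullet> M k (x k - z)) + (1 + \<theta> k) * (dir k \<bullet> M k (dir k))
      \<le> - (1 - \<sigma>) * (gap k \<bullet> M k (gap k))"
    using error_criterion_expanded[of k] by simp
  then have "(1 + \<theta> k) * (- 2 * (dir k \<bullet> M k (x k - z)) + (1 + \<theta> k) * (dir k \<bullet> M k (dir k)))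
      \<le> (1 + \<theta> k) * (- (1 - \<sigma>) * (gap k \<bullet> M k (gap k)))"
    using theta_ge[of k] theta_lower by (intro mult_left_mono) auto
  moreover have "(x (Suc k) - z) \<bullet> M k (x (Suc k) - z) = (x k - z) \<bullet> M k (x k - z)
      + (1 + \<theta> k) * (- 2 * (dir k \<bullet> M k (x k - z)) + (1 + \<theta> k) * (dir k \<bullet> M k (dir k)))"
  proof -
    have diff: "x (Suc k) - z = (x k - z) - (1 + \<theta> k) *\<^sub>R dir k" by (simp add: x_Suc)
    show ?thesis
      unfolding diff self_adjoint_quadratic_diff[OF metric_self_adjoint] by algebra
  qed
  ultimately show ?thesis
    by (simp only: mult.assoc mult_minus_left mult_minus_right)
qed

definition dir_bound :: real where
  "dir_bound = 2 * metric_bound / ((1 + \<theta>\<^sub>l) * \<omega>\<^sub>l)"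

text \<open>
  The right-hand side of the expanded error criterion is nonpositive, so the cross term
  \<open>\<langle>u\<^sub>k, M\<^sub>k d\<^sub>k\<rangle>\<close> must outweigh the terms in \<open>u\<^sub>k\<close> and \<open>\<epsilon>\<^sub>k\<close>. The resulting inequality is
  quadratic in \<open>\<parallel>u\<^sub>k\<parallel>\<close> on the left and linear on the right, so it yields
  \<open>\<parallel>u\<^sub>k\<parallel> = O(\<parallel>d\<^sub>k\<parallel>)\<close> and then \<open>\<epsilon>\<^sub>k = O(\<parallel>d\<^sub>k\<parallel>\<^sup>2)\<close>. Because \<open>\<theta>\<^sub>k\<close> and \<open>c\<^sub>k\<close> may be unbounded, only
  their lower bounds enter.
\<close>

lemma dir_eps_bound:
  "(1 + \<theta>\<^sub>l) * \<omega>\<^sub>l * (norm (dir k))\<^sup>2 + 2 * c\<^sub>l * \<epsilon> k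
    \<le> 2 * metric_bound * norm (dir k) * norm (gap k)"
proof -
  have "(1 + \<theta>\<^sub>l) * (\<omega>\<^sub>l * (norm (dir k))\<^sup>2) \<le> (1 + \<theta> k) * (dir k \<bullet> M k (dir k))"
    using theta_ge[of k] theta_lower omega_pos metric_lower by (intro mult_mono) auto
  moreover have "c\<^sub>l * \<epsilon> k \<le> c k * \<epsilon> k"
    using c_ge eps_nonneg by (intro mult_right_mono)
  moreover have "0 \<le> (1 - \<sigma>) * (gap k \<bullet> M k (gap k))"
    using sigma_range metric_nonneg by simp
  moreover have "- (dir k \<bullet> M k (gap k)) \<le> norm (dir k) * (metric_bound * norm (gap k))"
  proof -
    have "- (dir k \<bullet> M k (gap k)) \<le> norm (dir k) * norm (M k (gap k))"
      using Cauchy_Schwarz_ineq2[of "dir k" "M k (gap k)"] by linarith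
    also have "\<dots> \<le> norm (dir k) * (metric_bound * norm (gap k))"
      by (intro mult_left_mono metric_norm_le) auto
    finally show ?thesis .
  qed
  ultimately show ?thesis
    using error_criterion_expanded[of k] by (simp add: algebra_simps)
qed

lemma norm_dir_le: "norm (dir k) \<le> dir_bound * norm (gap k)"
proof -
  have pos: "0 < (1 + \<theta>\<^sub>l) * \<omega>\<^sub>l" using theta_lower omega_pos by simp
  have "0 \<le> 2 * c\<^sub>l * \<epsilon> k" using c_lower_pos eps_nonneg[of k] by simp
  then have "norm (dir k) * ((1 + \<theta>\<^sub>l) * \<omega>\<^sub>l * norm (dir k))
      \<le> norm (dir k) * (2 * metric_bound * norm (gap k))"
    using dir_eps_bound[of k] by (simp add: power2_eq_square mult_ac)
  then have "(1 + \<theta>\<^sub>l) * \<omega>\<^sub>l * norm (dir k) \<le> 2 * metric_bound * norm (gap k)"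
    using metric_bound_pos by (cases "dir k = 0") auto
  then show ?thesis
    using pos by (simp add: dir_bound_def pos_le_divide_eq mult.commute)
qed

lemma eps_le: "\<epsilon> k \<le> metric_bound / c\<^sub>l * norm (dir k) * norm (gap k)"
proof -
  have "0 \<le> (1 + \<theta>\<^sub>l) * \<omega>\<^sub>l * (norm (dir k))\<^sup>2" using theta_lower omega_pos by simp
  then have "c\<^sub>l * \<epsilon> k \<le> metric_bound * norm (dir k) * norm (gap k)"
    using dir_eps_bound[of k] by linarith
  then show ?thesis using c_lower_pos by (simp add: field_simps)
qed

lemma norm_v_le: "norm (v k) \<le> metric_bound / c\<^sub>l * norm (dir k)"
proof -
  have "c\<^sub>l * norm (v k) \<le> c k * norm (v k)"
    using c_ge by (intro mult_right_mono) auto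
  also have "\<dots> = norm (M k (dir k))"
    using c_pos[of k] by (simp add: metric_dir)
  also have "\<dots> \<le> metric_bound * norm (dir k)" by (rule metric_norm_le)
  finally show ?thesis using c_lower_pos by (simp add: field_simps)
qed

section \<open>The scaled distance to a zero\<close>

definition scaled_dist :: "'a \<Rightarrow> nat \<Rightarrow> real" where
  "scaled_dist z k = ((x k - z) \<bullet> M k (x k - z)) / growth k"

definition decrease_rate :: real where
  "decrease_rate = (1 + \<theta>\<^sub>l) * (1 - \<sigma>) * \<omega>\<^sub>l / exp (suminf \<xi>)"

lemma decrease_rate_pos: "0 < decrease_rate"
  using theta_lower sigma_range omega_pos by (simp add: decrease_rate_def)

lemma scaled_dist_nonneg: "0 \<le> scaled_dist z k"
  using growth_ge_1[of k] metric_nonneg by (simp add: scaled_dist_def)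

lemma scaled_dist_le: "scaled_dist z k \<le> metric_bound * (norm (x k - z))\<^sup>2"
proof -
  have "scaled_dist z k \<le> (x k - z) \<bullet> M k (x k - z)"
    using growth_ge_1[of k] divide_left_mono[of 1 "growth k" "(x k - z) \<bullet> M k (x k - z)"]
      metric_nonneg[of "x k - z" k]
    by (simp add: scaled_dist_def)
  then show ?thesis using metric_upper order_trans by blast
qed

lemma norm_sq_le_scaled_dist:
  "(norm (x k - z))\<^sup>2 \<le> exp (suminf \<xi>) / \<omega>\<^sub>l * scaled_dist z k"
proof -
  have "\<omega>\<^sub>l * (norm (x k - z))\<^sup>2 \<le> growth k * scaled_dist z k"
    using metric_lower[of "x k - z" k] growth_ge_1[of k] by (simp add: scaled_dist_def)
  also have "\<dots> \<le> exp (suminf \<xi>) * scaled_dist z k"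
    by (intro mult_right_mono growth_le scaled_dist_nonneg)
  finally show ?thesis using omega_pos by (simp add: field_simps)
qed

text \<open>
  The factor \<open>1 + \<xi>\<^sub>k\<close> lost in passing from \<open>M\<^sub>k\<close> to \<open>M\<^sub>k\<^sub>+\<^sub>1\<close> is the ratio of consecutive values of \<open>growth\<close>.
\<close>

lemma scaled_dist_decrease:
  assumes "0 \<in> T z"
  shows "scaled_dist z (Suc k) \<le> scaled_dist z k - decrease_rate * (norm (gap k))\<^sup>2"
proof -
  define r where "r = (1 + \<theta>\<^sub>l) * (1 - \<sigma>) * \<omega>\<^sub>l * (norm (gap k))\<^sup>2"
  have factor: "0 \<le> (1 + \<theta>\<^sub>l) * (1 - \<sigma>)" using theta_lower sigma_range by simp
  have "r = (1 + \<theta>\<^sub>l) * (1 - \<sigma>) * (\<omega>\<^sub>l * (norm (gap k))\<^sup>2)" by (simp add: r_def)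
  also have "\<dots> \<le> (1 + \<theta> k) * (1 - \<sigma>) * (gap k \<bullet> M k (gap k))"
    using theta_ge[of k] theta_lower factor sigma_range omega_pos
    by (intro mult_mono metric_lower mult_right_mono) auto
  finally have step: "(x (Suc k) - z) \<bullet> M k (x (Suc k) - z) \<le> (x k - z) \<bullet> M k (x k - z) - r"
    using step_decrease[OF assms, of k] by linarith
  have pos: "0 < growth k" using growth_ge_1[of k] by linarith
  have xi: "0 < 1 + \<xi> k" using xi_nonneg[of k] by linarith
  have "0 \<le> r" unfolding r_def using factor omega_pos by simp
  have "scaled_dist z (Suc k)
      \<le> ((1 + \<xi> k) * ((x (Suc k) - z) \<bullet> M k (x (Suc k) - z))) / growth (Suc k)"
    unfolding scaled_dist_def using metric_Suc_le growth_ge_1[of "Suc k"]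
    by (intro divide_right_mono) auto
  also have "\<dots> = ((x (Suc k) - z) \<bullet> M k (x (Suc k) - z)) / growth k"
    using xi by (simp add: growth_Suc)
  also have "\<dots> \<le> ((x k - z) \<bullet> M k (x k - z) - r) / growth k"
    using step pos by (intro divide_right_mono) auto
  also have "\<dots> = scaled_dist z k - r / growth k"
    by (simp add: scaled_dist_def diff_divide_distrib)
  also have "\<dots> \<le> scaled_dist z k - r / exp (suminf \<xi>)"
    using pos growth_le[of k] \<open>0 \<le> r\<close> by (intro diff_left_mono divide_left_mono) auto
  finally show ?thesis by (simp add: r_def decrease_rate_def)
qed

lemma scaled_dist_decseq:
  assumes "0 \<in> T z"
  shows "decseq (scaled_dist z)"
  unfolding decseq_Suc_iff
proof
  fix k
  have "0 \<le> decrease_rate * (norm (gap k))\<^sup>2" using decrease_rate_pos by simp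
  then show "scaled_dist z (Suc k) \<le> scaled_dist z k"
    using scaled_dist_decrease[OF assms, of k] by linarith
qed

lemma scaled_dist_convergent:
  assumes "0 \<in> T z"
  shows "\<exists>l. scaled_dist z \<longlonglongrightarrow> l"
proof -
  have "\<forall>k. 0 \<le> scaled_dist z k" by (simp add: scaled_dist_nonneg)
  then show ?thesis
    by (rule decseq_convergent[OF scaled_dist_decseq[OF assms]]) (rule exI)
qed

section \<open>Convergence\<close>

lemma gap_tendsto_0:
  assumes "0 \<in> T z"
  shows "gap \<longlonglongrightarrow> 0"
proof -
  obtain l where "scaled_dist z \<longlonglongrightarrow> l"
    using scaled_dist_convergent[OF assms] by blast
  then have "(\<lambda>k. (scaled_dist z k - scaled_dist z (Suc k)) / decrease_rate)
      \<longlonglongrightarrow> (l - l) / decrease_rate"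
    using decrease_rate_pos LIMSEQ_Suc[of "scaled_dist z" l] by (intro tendsto_intros) auto
  then have diff: "(\<lambda>k. (scaled_dist z k - scaled_dist z (Suc k)) / decrease_rate) \<longlonglongrightarrow> 0"
    by simp
  have "(norm (gap k))\<^sup>2 \<le> (scaled_dist z k - scaled_dist z (Suc k)) / decrease_rate" for k
    using scaled_dist_decrease[OF assms, of k] decrease_rate_pos by (simp add: field_simps)
  then have "(\<lambda>k. (norm (gap k))\<^sup>2) \<longlonglongrightarrow> 0"
    by (intro Lim_null_comparison[OF _ diff]) simp
  then show ?thesis
    by (simp add: tendsto_norm_zero_iff)
qed

lemma dir_tendsto_0:
  assumes "gap \<longlonglongrightarrow> 0"
  shows "dir \<longlonglongrightarrow> 0"
proof (rule Lim_null_comparison)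
  show "\<forall>\<^sub>F k in sequentially. norm (dir k) \<le> dir_bound * norm (gap k)"
    using norm_dir_le by simp
  show "(\<lambda>k. dir_bound * norm (gap k)) \<longlonglongrightarrow> 0"
    using assms by (intro tendsto_mult_right_zero tendsto_norm_zero)
qed

lemma v_tendsto_0:
  assumes "gap \<longlonglongrightarrow> 0"
  shows "v \<longlonglongrightarrow> 0"
proof (rule Lim_null_comparison)
  show "\<forall>\<^sub>F k in sequentially. norm (v k) \<le> metric_bound / c\<^sub>l * norm (dir k)"
    using norm_v_le by simp
  show "(\<lambda>k. metric_bound / c\<^sub>l * norm (dir k)) \<longlonglongrightarrow> 0"
    using dir_tendsto_0[OF assms] by (intro tendsto_mult_right_zero tendsto_norm_zero)
qed

lemma eps_tendsto_0:
  assumes "gap \<longlonglongrightarrow> 0"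
  shows "\<epsilon> \<longlonglongrightarrow> 0"
proof (rule Lim_null_comparison)
  show "\<forall>\<^sub>F k in sequentially.
      norm (\<epsilon> k) \<le> metric_bound / c\<^sub>l * norm (dir k) * norm (gap k)"
    using eps_le eps_nonneg by simp
  show "(\<lambda>k. metric_bound / c\<^sub>l * norm (dir k) * norm (gap k)) \<longlonglongrightarrow> 0"
    using dir_tendsto_0[OF assms] assms
    by (intro tendsto_mult_zero tendsto_mult_right_zero tendsto_norm_zero)
qed

lemma x_bounded:
  assumes "0 \<in> T z"
  shows "bounded (range x)"
proof -
  define R where "R = exp (suminf \<xi>) / \<omega>\<^sub>l * scaled_dist z 0"
  have "norm (x k - z) \<le> sqrt R" for k
  proof (rule real_le_rsqrt)
    have "scaled_dist z k \<le> scaled_dist z 0"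
      using scaled_dist_decseq[OF assms] by (simp add: decseqD)
    then have "exp (suminf \<xi>) / \<omega>\<^sub>l * scaled_dist z k \<le> R"
      unfolding R_def using omega_pos by (intro mult_left_mono) auto
    then show "(norm (x k - z))\<^sup>2 \<le> R"
      using norm_sq_le_scaled_dist[of k z] by linarith
  qed
  then have "range x \<subseteq> cball z (sqrt R)"
    by (auto simp: dist_norm norm_minus_commute)
  then show ?thesis using bounded_cball bounded_subset by blast
qed

text \<open>
  A zero of \<open>T\<close> that is a cluster point of the iterates is their limit: the scaled distance to
  it is monotone, so its limit can be read off along the subsequence.
\<close>

lemma x_tendsto_of_cluster_zero:
  assumes "0 \<in> T p" and "strict_mono s" and "(x \<circ> s) \<longlonglongrightarrow> p"
  shows "x \<longlonglongrightarrow> p"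
proof -
  obtain l where l: "scaled_dist p \<longlonglongrightarrow> l"
    using scaled_dist_convergent[OF assms(1)] by blast
  have "(\<lambda>k. (x \<circ> s) k - p) \<longlonglongrightarrow> 0"
    by (rule LIM_zero[OF assms(3)])
  then have "(\<lambda>k. metric_bound * (norm ((x \<circ> s) k - p))\<^sup>2) \<longlonglongrightarrow> metric_bound * (norm (0::'a))\<^sup>2"
    by (intro tendsto_intros)
  then have "(\<lambda>k. metric_bound * (norm (x (s k) - p))\<^sup>2) \<longlonglongrightarrow> 0" by simp
  then have "(scaled_dist p \<circ> s) \<longlonglongrightarrow> 0"
    by (rule Lim_null_comparison[rotated]) (simp add: scaled_dist_nonneg scaled_dist_le)
  then have "l = 0"
    by (rule LIMSEQ_unique[OF LIMSEQ_subseq_LIMSEQ[OF l assms(2)]])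
  then have "(\<lambda>k. exp (suminf \<xi>) / \<omega>\<^sub>l * scaled_dist p k) \<longlonglongrightarrow> 0"
    using l by (intro tendsto_mult_right_zero) simp
  then have "(\<lambda>k. (norm (x k - p))\<^sup>2) \<longlonglongrightarrow> 0"
    by (rule Lim_null_comparison[rotated])
      (simp only: real_norm_def abs_power2 norm_sq_le_scaled_dist eventually_True)
  then have "(\<lambda>k. x k - p) \<longlonglongrightarrow> 0"
    by (simp add: tendsto_norm_zero_iff)
  then show ?thesis by (rule LIM_zero_cancel)
qed

lemma converges_to_common_zero:
  assumes "maximal_monotone_op T" and "0 \<in> T z"
  shows "\<exists>p. 0 \<in> T p \<and> x \<longlonglongrightarrow> p \<and> y \<longlonglongrightarrow> p"
proof -
  obtain p s where s: "strict_mono s" and p: "(x \<circ> s) \<longlonglongrightarrow> p"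
    using bounded_imp_convergent_subsequence[OF x_bounded[OF assms(2)]] by auto
  have gap: "gap \<longlonglongrightarrow> 0" by (rule gap_tendsto_0[OF assms(2)])
  have "(\<lambda>k. (x \<circ> s) k + (gap \<circ> s) k) \<longlonglongrightarrow> p + 0"
    by (rule tendsto_add[OF p LIMSEQ_subseq_LIMSEQ[OF gap s]])
  then have y_lim: "(y \<circ> s) \<longlonglongrightarrow> p" by (simp add: gap_def o_def)
  have mem: "((y \<circ> s) k, (v \<circ> s) k) \<in> gph (enlargement ((\<epsilon> \<circ> s) k) T)" for k
    by (simp add: inclusion)
  have zero: "0 \<in> T p"
    by (rule zero_of_limit_enlargement[OF assms(1) mem y_lim
          LIMSEQ_subseq_LIMSEQ[OF v_tendsto_0[OF gap] s]
          LIMSEQ_subseq_LIMSEQ[OF eps_tendsto_0[OF gap] s]])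
  have x_lim: "x \<longlonglongrightarrow> p" by (rule x_tendsto_of_cluster_zero[OF zero s p])
  moreover have "y \<longlonglongrightarrow> p"
    using tendsto_add[OF x_lim gap] by (simp add: gap_def)
  ultimately show ?thesis using zero by blast
qed

end

theorem theorem1:
  fixes T :: "'a::euclidean_space \<Rightarrow> 'a set"
    and \<omega>\<^sub>l \<omega>\<^sub>u \<theta>\<^sub>l \<sigma> c\<^sub>l :: real
    and \<xi> c \<theta> \<epsilon> :: "nat \<Rightarrow> real"
    and M :: "nat \<Rightarrow> 'a \<Rightarrow> 'a"
    and x y v :: "nat \<Rightarrow> 'a"
  assumes "maximal_monotone_op T"
    and "inverse_op T 0 \<noteq> {}"
    and "VMOR_HPE T \<omega>\<^sub>l \<omega>\<^sub>u \<theta>\<^sub>l \<sigma> c\<^sub>l \<xi> M c \<theta> \<epsilon> x y v"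
  shows "\<exists>x_inf \<in> inverse_op T 0. x \<longlonglongrightarrow> x_inf \<and> y \<longlonglongrightarrow> x_inf"
proof -
  obtain z where "0 \<in> T z" using assms(2) by (auto simp: inverse_op_def)
  then show ?thesis
    using VMOR_HPE.converges_to_common_zero[OF assms(3,1)] by (simp add: inverse_op_def Bex_def)
qed

end
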